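(* Let $C_1,C_2$ be 2-copulas that are stochastically monotone in the first component. Then $C_1*C_2$ is again stochastically monotone in the first component. More precisely, $C_1*C_2$ is (1) stochastically increasing in the first component if $C_1$ and $C_2$ are both stochastically increasing or both stochastically decreasing in the first component; (2) stochastically decreasing in the first component if one of $C_1,C_2$ is stochastically increasing and the other is stochastically decreasing in the first component.
   Context: A 2-copula is a bivariate distribution function on $[0,1]^2$ with uniform margins. The Markov product of 2-copulas $C_1,C_2$ is the 2-copula $(C_1*C_2)(u,v)=\int_0^1\partial_2C_1(u,t)\,\partial_1C_2(t,v)\,\mathrm{d}t$. A 2-copula $C$ is stochastically increasing (decreasing) in the first component if, for every $v\in[0,1]$, the function $u\mapsto\partial_1C(u,v)$ agrees almost everywhere with a (non-strictly) decreasing (increasing) function; equivalently, $u\mapsto C(u,v)$ is concave (convex) for every $v$. $C$ is stochastically monotone in the first component if it is stochastically increasing or stochastically decreasing in the first component. *)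

theory Defs
  imports "HOL-Probability.Probability"
begin

text \<open>
  Copulas are represented as total functions on \<open>real\<close>; only their values on the unit
  square matter. The equations for the two margins force the measure to be concentrated on
  the unit square.
\<close>

definition copula2 :: "(real \<Rightarrow> real \<Rightarrow> real) \<Rightarrow> bool" where
  "copula2 C \<longleftrightarrow>
     (\<exists>M :: (real \<times> real) measure.
        prob_space M \<and> sets M = sets borel \<and>
        distr M borel fst = uniform_measure lborel {0..1} \<and>
        distr M borel snd = uniform_measure lborel {0..1} \<and>
        (\<forall>u\<in>{0..1}. \<forall>v\<in>{0..1}. C u v = measure M ({..u} \<times> {..v})))"

text \<open>
  Sections of a copula are 1-Lipschitz on the unit interval, so the partial derivatives below
  exist for almost every value of the differentiated variable. The unspecified value of
  \<open>deriv\<close> at the remaining points, and outside the unit interval, is irrelevant to the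
  integral and to the almost-everywhere statements.
\<close>

definition partial1 :: "(real \<Rightarrow> real \<Rightarrow> real) \<Rightarrow> real \<Rightarrow> real \<Rightarrow> real" where
  "partial1 C u v = deriv (\<lambda>x. C x v) u"

definition partial2 :: "(real \<Rightarrow> real \<Rightarrow> real) \<Rightarrow> real \<Rightarrow> real \<Rightarrow> real" where
  "partial2 C u v = deriv (\<lambda>y. C u y) v"

definition markov_product ::
    "(real \<Rightarrow> real \<Rightarrow> real) \<Rightarrow> (real \<Rightarrow> real \<Rightarrow> real) \<Rightarrow> real \<Rightarrow> real \<Rightarrow> real" where
  "markov_product C1 C2 u v = (LINT t:{0..1}|lebesgue. partial2 C1 u t * partial1 C2 t v)"

text \<open>Note the reversal: stochastically increasing means a decreasing partial derivative.\<close>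

definition stoch_increasing1 :: "(real \<Rightarrow> real \<Rightarrow> real) \<Rightarrow> bool" where
  "stoch_increasing1 C \<longleftrightarrow>
     (\<forall>v\<in>{0..1}. \<exists>g :: real \<Rightarrow> real.
        antimono_on {0..1} g \<and> (AE u in lebesgue_on {0..1}. partial1 C u v = g u))"

definition stoch_decreasing1 :: "(real \<Rightarrow> real \<Rightarrow> real) \<Rightarrow> bool" where
  "stoch_decreasing1 C \<longleftrightarrow>
     (\<forall>v\<in>{0..1}. \<exists>g :: real \<Rightarrow> real.
        mono_on {0..1} g \<and> (AE u in lebesgue_on {0..1}. partial1 C u v = g u))"

definition stoch_monotone1 :: "(real \<Rightarrow> real \<Rightarrow> real) \<Rightarrow> bool" where
  "stoch_monotone1 C \<longleftrightarrow> stoch_increasing1 C \<or> stoch_decreasing1 C"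

end

theory Submission
  imports Defs
begin

text \<open>
  Two things have to be shown: the Markov product is a copula, and it inherits stochastic
  monotonicity.

  Both rest on a representation of the partial derivatives. For a copula with joint law \<open>M\<close>
  the measure \<open>A \<mapsto> M (A \<times> {..v})\<close> has a density with values in \<open>{0..1}\<close>
  (\<open>section_density_exists\<close>), and Lebesgue's differentiation theorem identifies this density almost
  everywhere with the partial derivative (\<open>partial1_eq_dens\<close>). The product is therefore the integral
  of a product of two such densities (\<open>markov_product_eq_LINT\<close>).

  The product of \<open>C1\<close> and \<open>C2\<close> is the distribution function of a vector \<open>(X, Z)\<close> for a Markov
  triple \<open>(X, Y, Z)\<close> in which \<open>(X, Y)\<close> has distribution \<open>C1\<close> and \<open>(Y, Z)\<close> has distribution
  \<open>C2\<close>. Such a triple is obtained by drawing \<open>(X, Y)\<close> and an independent uniform \<open>W\<close>, and letting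
  \<open>Z\<close> be the conditional quantile of the second coordinate of \<open>C2\<close> given \<open>Y\<close>, evaluated at \<open>W\<close>
  (\<open>measure_glue_quant\<close>).

  For monotonicity, stochastically decreasing (increasing) in the first component is the same
  as convexity (concavity) of all sections \<open>\<lambda>u. C u v\<close>. The deviation of the product from
  convexity is an integral \<open>\<integral>h m\<close>, where \<open>m\<close> is a monotone version of the derivative of \<open>C2\<close>
  and the primitive of \<open>h\<close> is the deviation of \<open>C1\<close> from convexity, which has constant sign
  and vanishes at both ends of the unit interval. The second mean value theorem for integrals
  yields the sign of such an integral (\<open>convex_markov_product\<close>). The two signs multiply, with one
  reversal since integration by parts would move the derivative from \<open>h\<close> to \<open>m\<close> at the cost of a
  minus sign.
\<close>

section \<open>Indefinite integrals and convexity\<close>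

lemma AE_lebesgue_on_iff_negligible:
  fixes S :: "real set"
  assumes "S \<in> sets lebesgue"
  shows "(AE x in lebesgue_on S. P x) \<longleftrightarrow> negligible {x \<in> S. \<not> P x}"
proof -
  have "(AE x in lebesgue_on S. P x) \<longleftrightarrow> (AE x in lebesgue. x \<in> S \<longrightarrow> P x)"
    using assms by (simp add: AE_restrict_space_iff)
  also have "\<dots> \<longleftrightarrow> negligible {x \<in> S. \<not> P x}"
    by (auto simp: eventually_ae_filter_negligible intro: negligible_subset)
  finally show ?thesis .
qed

text \<open>
  Lebesgue's differentiation theorem on an interval. The differentiation theorem for right-hand
  averages \<open>integral {x..x + h} f / h\<close> is applied to \<open>f\<close>, extended by zero, and to its
  reflection \<open>\<lambda>x. f (- x)\<close>, which supplies the left-hand averages.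
\<close>

lemma AE_has_real_derivative_integral:
  fixes f :: "real \<Rightarrow> real"
  assumes f: "f integrable_on {a..b}"
  obtains N where "negligible N"
    and "\<And>x. x \<in> {a<..<b} - N \<Longrightarrow>
           ((\<lambda>u. integral {a..u} f) has_real_derivative f x) (at x)"
proof -
  define F where "F = (\<lambda>x. if x \<in> {a..b} then f x else 0)"
  have FU: "F integrable_on UNIV"
    unfolding F_def using f by (simp only: integrable_restrict_UNIV)
  have F: "F integrable_on cbox c d" for c d
    by (rule integrable_on_subcbox[OF FU]) simp
  have F': "(\<lambda>x. F (- x)) integrable_on cbox c d" for c d
    using F[of "-d" "-c"] integrable_reflect[of F "-c" "-d"] by simp
  obtain N1 where N1: "negligible N1" "\<And>x e. \<lbrakk>x \<notin> N1; 0 < e\<rbrakk> \<Longrightarrow>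
      \<exists>d>0. \<forall>h. 0 < h \<and> h < d \<longrightarrow> norm (integral (cbox x (x + h *\<^sub>R One)) F /\<^sub>R h ^ DIM(real) - F x) < e"
    using integrable_ccontinuous_explicit[OF F] by metis
  obtain N2 where N2: "negligible N2" "\<And>x e. \<lbrakk>x \<notin> N2; 0 < e\<rbrakk> \<Longrightarrow>
      \<exists>d>0. \<forall>h. 0 < h \<and> h < d \<longrightarrow>
        norm (integral (cbox x (x + h *\<^sub>R One)) (\<lambda>x. F (- x)) /\<^sub>R h ^ DIM(real) - F (- x)) < e"
    using integrable_ccontinuous_explicit[OF F'] by metis
  show thesis
  proof
    show "negligible (N1 \<union> uminus ` N2)"
      using N1(1) N2(1) by (auto intro!: negligible_differentiable_image_negligible derivative_intros)
    fix x assume x: "x \<in> {a<..<b} - (N1 \<union> uminus ` N2)"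
    then have x1: "x \<notin> N1" and x2: "- x \<notin> N2" by (auto simp: image_iff)
    let ?G = "\<lambda>u. integral {a..u} f"
    have G: "?G d - ?G c = integral {c..d} F" if "a \<le> c" "c \<le> d" "d \<le> b" for c d
    proof -
      have "f integrable_on {a..d}"
        using f by (rule integrable_on_subinterval) (use that in auto)
      then have "?G c + integral {c..d} f = ?G d"
        using that by (intro Henstock_Kurzweil_Integration.integral_combine) auto
      moreover have "integral {c..d} f = integral {c..d} F"
        using that by (intro Henstock_Kurzweil_Integration.integral_cong) (auto simp: F_def)
      ultimately show ?thesis by simp
    qed
    have Fx: "F x = f x" using x by (simp add: F_def)
    show "(?G has_real_derivative f x) (at x)"
      unfolding DERIV_def LIM_eq
    proof (intro allI impI)
      fix e :: real assume "0 < e"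
      from N1(2)[OF x1 this] obtain d1 where d1: "d1 > 0"
        "\<And>h. 0 < h \<Longrightarrow> h < d1 \<Longrightarrow> \<bar>integral {x..x+h} F / h - f x\<bar> < e"
        by (auto simp: divide_inverse_commute Fx)
      from N2(2)[OF x2 \<open>0 < e\<close>] obtain d2 where d2: "d2 > 0"
        "\<And>h. 0 < h \<Longrightarrow> h < d2 \<Longrightarrow> \<bar>integral {-x..-x+h} (\<lambda>x. F (-x)) / h - f x\<bar> < e"
        by (auto simp: divide_inverse_commute Fx)
      have refl: "integral {-x..-x+h} (\<lambda>x. F (-x)) = integral {x-h..x} F" for h
        using Henstock_Kurzweil_Integration.integral_reflect_real[of x "x - h" F] by simp
      show "\<exists>s>0. \<forall>h::real. h \<noteq> 0 \<and> norm (h - 0) < s \<longrightarrow> norm ((?G (x + h) - ?G x) / h - f x) < e"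
      proof (intro exI[of _ "min (min d1 d2) (min (x - a) (b - x))"] conjI allI impI)
        show "0 < min (min d1 d2) (min (x - a) (b - x))"
          using d1(1) d2(1) x by auto
        fix h :: real assume h: "h \<noteq> 0 \<and> norm (h - 0) < min (min d1 d2) (min (x - a) (b - x))"
        show "norm ((?G (x + h) - ?G x) / h - f x) < e"
        proof (cases "h > 0")
          case True
          then show ?thesis using h d1(2)[of h] G[of x "x + h"] x by auto
        next
          case False
          then have "?G (x + h) - ?G x = - integral {x - (- h)..x} F"
            using h G[of "x + h" x] x by auto
          then have "(?G (x + h) - ?G x) / h = integral {-x..-x+(-h)} (\<lambda>x. F (-x)) / (- h)"
            unfolding refl by simp
          then show ?thesis using False h d2(2)[of "- h"] by auto
        qed
      qed
    qed
  qed
qed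

text \<open>
  At a point \<open>w\<close> between \<open>x\<close> and \<open>y\<close>, the value \<open>g w\<close> bounds the slope of \<open>G\<close> over \<open>{x..w}\<close> from
  above and the slope over \<open>{w..y}\<close> from below.
\<close>

lemma convex_on_integral_of_mono:
  fixes g G :: "real \<Rightarrow> real"
  assumes g: "mono_on {0..1} g"
    and G: "\<And>u. u \<in> {0..1} \<Longrightarrow> (g has_integral G u) {0..u}"
  shows "convex_on {0..1} G"
proof -
  have incr: "(g has_integral (G y - G x)) {x..y}" if "0 \<le> x" "x \<le> y" "y \<le> 1" for x y
  proof -
    have "g integrable_on {0..y}" using G[of y] that by auto
    then have "g integrable_on {x..y}"
      by (rule integrable_on_subinterval) (use that in auto)
    moreover have "integral {0..x} g + integral {x..y} g = integral {0..y} g"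
      using that \<open>g integrable_on {0..y}\<close>
      by (intro Henstock_Kurzweil_Integration.integral_combine) auto
    ultimately show ?thesis
      using integral_unique[OF G[of x]] integral_unique[OF G[of y]] that
      by (auto simp: has_integral_integrable_integral)
  qed
  have up: "G y - G x \<le> g y * (y - x)" and lo: "g x * (y - x) \<le> G y - G x"
    if "0 \<le> x" "x \<le> y" "y \<le> 1" for x y
  proof -
    have 1: "((\<lambda>_. g c) has_integral g c * (y - x)) {x..y}" for c
      using has_integral_const_real[of "g c" x y] that by (simp add: mult.commute)
    show "G y - G x \<le> g y * (y - x)"
      by (rule has_integral_le[OF incr[OF that] 1]) (use that in \<open>auto intro!: mono_onD[OF g]\<close>)
    show "g x * (y - x) \<le> G y - G x"
      by (rule has_integral_le[OF 1 incr[OF that]]) (use that in \<open>auto intro!: mono_onD[OF g]\<close>)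
  qed
  show ?thesis
  proof (rule convex_on_linorderI)
    fix t x y :: real
    assume t: "0 < t" "t < 1" and xy: "x \<in> {0..1}" "y \<in> {0..1}" "x < y"
    let ?w = "(1 - t) *\<^sub>R x + t *\<^sub>R y"
    have w: "?w - x = t * (y - x)" "y - ?w = (1 - t) * (y - x)"
      by (simp_all add: algebra_simps)
    have "x \<le> ?w" using w(1) t xy by (smt (verit) mult_nonneg_nonneg)
    moreover have "?w \<le> y" using w(2) t xy by (smt (verit) mult_nonneg_nonneg)
    ultimately have "G ?w - G x \<le> g ?w * (?w - x)" "g ?w * (y - ?w) \<le> G y - G ?w"
      using xy by (auto intro!: up lo)
    then have "(1 - t) * (G ?w - G x) \<le> (1 - t) * (g ?w * (t * (y - x)))"
       "t * (g ?w * ((1 - t) * (y - x))) \<le> t * (G y - G ?w)"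
      unfolding w using t by (auto intro!: mult_left_mono)
    then show "G ?w \<le> (1 - t) * G x + t * G y"
      by (simp add: algebra_simps)
  qed simp
qed

text \<open>
  The derivative of a convex function is only available almost everywhere, whereas the notion of
  stochastic monotonicity asks for a version that is monotone on the whole interval.
\<close>

lemma bounded_mono_on_extension:
  fixes h :: "real \<Rightarrow> real"
  assumes h: "mono_on S h" and b: "\<And>x. x \<in> S \<Longrightarrow> \<bar>h x\<bar> \<le> B"
  obtains g where "mono_on T g" "\<And>x. x \<in> S \<Longrightarrow> g x = h x"
proof
  \<comment> \<open>The bound \<open>- B\<close> keeps the set nonempty where no point of \<open>S\<close> lies to the left.\<close>
  define g where "g = (\<lambda>x. Sup (insert (- B) (h ` {y \<in> S. y \<le> x})))"
  have bdd: "bdd_above (insert (- B) (h ` {y \<in> S. y \<le> x}))" for x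
    using b by (intro bdd_aboveI[of _ "\<bar>B\<bar>"]) (fastforce simp: abs_le_iff)
  show "mono_on T g"
    unfolding g_def by (intro mono_onI cSup_subset_mono bdd) auto
  show "g x = h x" if x: "x \<in> S" for x
    unfolding g_def
  proof (rule cSup_eq_maximum)
    show "h x \<in> insert (- B) (h ` {y \<in> S. y \<le> x})" using x by auto
    fix z assume "z \<in> insert (- B) (h ` {y \<in> S. y \<le> x})"
    then show "z \<le> h x"
      using b[OF x] x by (auto intro: mono_onD[OF h])
  qed
qed

text \<open>
  The graph lies above the tangent at \<open>x\<close> and above the tangent at \<open>y\<close>; adding the two
  inequalities compares the slopes.
\<close>

lemma mono_on_derivative_of_convex:
  fixes G :: "real \<Rightarrow> real"
  assumes G: "convex_on {a..b} G" and S: "S \<subseteq> {a<..<b}"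
    and d: "\<And>x. x \<in> S \<Longrightarrow> (G has_real_derivative h x) (at x)"
  shows "mono_on S h"
proof (rule mono_onI)
  fix x y assume xy: "x \<in> S" "y \<in> S" "x \<le> y"
  have tan: "G z - G c \<ge> h c * (z - c)" if "c \<in> S" "z \<in> S" for c z
    by (rule convex_on_imp_above_tangent[OF G])
      (use that S d in \<open>auto intro: has_field_derivative_at_within\<close>)
  have "(h y - h x) * (y - x) \<ge> 0"
    using tan[of x y] tan[of y x] xy by (simp add: algebra_simps)
  then show "h x \<le> h y"
    using xy by (cases "x = y") (auto simp: zero_le_mult_iff)
qed

section \<open>Comparison of integrals\<close>

text \<open>
  Otherwise integrating over the set where \<open>g < f\<close> reverses the inequality strictly; finiteness
  of the integral of \<open>g\<close> makes the strict comparison legitimate.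
\<close>

lemma AE_le_if_set_nn_integral_le:
  assumes [measurable]: "f \<in> borel_measurable M" "g \<in> borel_measurable M"
    and fin: "(\<integral>\<^sup>+x. g x \<partial>M) \<noteq> \<infinity>"
    and le: "\<And>A. A \<in> sets M \<Longrightarrow> (\<integral>\<^sup>+x. f x * indicator A x \<partial>M) \<le> (\<integral>\<^sup>+x. g x * indicator A x \<partial>M)"
  shows "AE x in M. f x \<le> g x"
proof (rule ccontr)
  assume neg: "\<not> (AE x in M. f x \<le> g x)"
  define A where "A = {x \<in> space M. g x < f x}"
  have A[measurable]: "A \<in> sets M" unfolding A_def by measurable
  have "(\<integral>\<^sup>+x. g x * indicator A x \<partial>M) < (\<integral>\<^sup>+x. f x * indicator A x \<partial>M)"
  proof (rule nn_integral_less)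
    have "(\<integral>\<^sup>+x. g x * indicator A x \<partial>M) \<le> (\<integral>\<^sup>+x. g x \<partial>M)"
      by (intro nn_integral_mono) (auto simp: indicator_def)
    then show "(\<integral>\<^sup>+x. g x * indicator A x \<partial>M) \<noteq> \<infinity>"
      using fin by (auto simp: top_unique)
    show "AE x in M. g x * indicator A x \<le> f x * indicator A x"
      by (intro AE_I2) (auto simp: A_def indicator_def)
    show "\<not> (AE x in M. f x * indicator A x \<le> g x * indicator A x)"
    proof
      assume "AE x in M. f x * indicator A x \<le> g x * indicator A x"
      then have "AE x in M. f x \<le> g x"
        by (rule AE_mp) (intro AE_I2, auto simp: A_def indicator_def split: if_splits)
      with neg show False ..
    qed
  qed measurable
  with le[OF A] show False by simp
qed

lemma LINT_product_bounds:
  fixes k h :: "real \<Rightarrow> real"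
  assumes [measurable]: "k \<in> borel_measurable borel" "h \<in> borel_measurable borel"
    and k: "\<And>t. 0 \<le> k t" "\<And>t. k t \<le> 1"
    and h: "integrable lborel h" "AE t in lborel. 0 \<le> h t"
  shows "0 \<le> (LINT t|lborel. k t * h t)" "(LINT t|lborel. k t * h t) \<le> (LINT t|lborel. h t)"
proof -
  have i: "integrable lborel (\<lambda>t. k t * h t)"
    by (rule Bochner_Integration.integrable_bound[OF h(1)])
      (use k in \<open>auto simp: abs_mult intro!: mult_left_le_one_le\<close>)
  show "0 \<le> (LINT t|lborel. k t * h t)"
    by (rule integral_nonneg_AE) (use h(2) k in \<open>auto elim!: eventually_mono\<close>)
  show "(LINT t|lborel. k t * h t) \<le> (LINT t|lborel. h t)"
    by (rule integral_mono_AE[OF i h(1)])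
      (use h(2) k in \<open>auto elim!: eventually_mono intro!: mult_left_le_one_le\<close>)
qed

section \<open>Densities of the sections of a copula\<close>

lemma uniform_unit_interval:
  "uniform_measure lborel {0..1::real} = density lborel (indicator {0..1})"
  by (simp add: uniform_measure_def divide_ennreal_def)

lemma measure_uniform_unit_atMost:
  "measure (uniform_measure lborel {0..1::real}) {..x} = min 1 (max 0 x)"
proof -
  have "{0..1} \<inter> {..x} = (if x < 0 then {} else {0..min 1 x})" by auto
  then show ?thesis
    by (subst measure_uniform_measure) auto
qed

lemma prob_space_uniform_unit: "prob_space (uniform_measure lborel {0..1::real})"
  by (rule prob_space_uniform_measure) auto

lemma indicator_times_mult: "indicator (A \<times> B) p = (indicator A (fst p) * indicator B (snd p) :: ennreal)"
  by (cases p) (auto simp: indicator_def)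

text \<open>
  A copula together with a random vector that it is the distribution function of: \<open>M\<close> is the
  joint law, and \<open>C\<close> is pinned down by it only on the unit square.
\<close>

locale copula_law = prob_space M for M :: "(real \<times> real) measure" +
  fixes C :: "real \<Rightarrow> real \<Rightarrow> real"
  assumes sets_M [measurable_cong]: "sets M = sets borel"
    and fst_M: "distr M borel fst = uniform_measure lborel {0..1}"
    and snd_M: "distr M borel snd = uniform_measure lborel {0..1}"
    and C_eq: "\<And>u v. u \<in> {0..1} \<Longrightarrow> v \<in> {0..1} \<Longrightarrow> C u v = measure M ({..u} \<times> {..v})"

lemma copula2_iff: "copula2 C \<longleftrightarrow> (\<exists>M. copula_law M C)"
  by (auto simp: copula2_def copula_law_def copula_law_axioms_def)

context copula_law
begin

lemma space_M: "space M = UNIV"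
  using sets_eq_imp_space_eq[OF sets_M] by simp

lemma sets_M_prod [measurable_cong]: "sets M = sets (borel \<Otimes>\<^sub>M borel)"
  unfolding borel_prod by (rule sets_M)

lemma nn_integral_fst:
  assumes [measurable]: "k \<in> borel_measurable borel"
  shows "(\<integral>\<^sup>+p. k (fst p) \<partial>M) = (\<integral>\<^sup>+x. k x * indicator {0..1} x \<partial>lborel)"
proof -
  have "(\<integral>\<^sup>+p. k (fst p) \<partial>M) = (\<integral>\<^sup>+x. k x \<partial>distr M borel fst)"
    by (subst nn_integral_distr) measurable
  also have "\<dots> = (\<integral>\<^sup>+x. k x * indicator {0..1} x \<partial>lborel)"
    unfolding fst_M uniform_unit_interval by (subst nn_integral_density) (auto simp: mult.commute)
  finally show ?thesis .
qed

lemma transpose: "copula_law (distr M borel prod.swap) (\<lambda>u v. C v u)"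
proof -
  have [measurable]: "prod.swap \<in> measurable M (borel :: (real \<times> real) measure)"
    unfolding borel_prod[symmetric] prod.swap_def by measurable
  have [measurable]: "fst \<in> measurable (borel :: (real \<times> real) measure) borel"
    "snd \<in> measurable (borel :: (real \<times> real) measure) borel"
    unfolding borel_prod[symmetric] by measurable
  have m: "measure M ({..v} \<times> {..u}) = measure (distr M borel prod.swap) ({..u} \<times> {..v})" for u v :: real
    by (subst measure_distr) (auto intro!: arg_cong[where f = "measure M"] simp: space_M borel_Times)
  show ?thesis
  proof (intro copula_law.intro prob_space_distr copula_law_axioms.intro)
    show "distr (distr M borel prod.swap) borel fst = uniform_measure lborel {0..1}"
      by (subst distr_distr) (auto simp: comp_def snd_M)
    show "distr (distr M borel prod.swap) borel snd = uniform_measure lborel {0..1}"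
      by (subst distr_distr) (auto simp: comp_def fst_M)
  qed (simp_all add: C_eq m)
qed

text \<open>
  The measure \<open>A \<mapsto> M (A \<times> {..v})\<close> is dominated by the first margin, that is by Lebesgue measure on
  the unit interval, and so has a density between 0 and 1. Probabilistically the density at \<open>x\<close>
  is the conditional probability that the second coordinate is at most \<open>v\<close>, given that the first
  one is \<open>x\<close>. Testing against arbitrary functions \<open>k\<close> of the first coordinate is what the
  disintegration of events of the glued law requires later.
\<close>

lemma section_density_exists:
  "\<exists>f \<in> borel_measurable borel. (\<forall>x. 0 \<le> f x \<and> f x \<le> indicator {0..1} x) \<and>
     (\<forall>k \<in> borel_measurable borel.
        (\<integral>\<^sup>+p. k (fst p) * indicator {..v} (snd p) \<partial>M) = (\<integral>\<^sup>+x. k x * ennreal (f x) \<partial>lborel))"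
proof -
  define N where "N = distr (density M (\<lambda>p. indicator {..v} (snd p))) borel fst"
  have setsN: "sets N = sets lborel" by (simp add: N_def)
  have N: "(\<integral>\<^sup>+x. k x \<partial>N) = (\<integral>\<^sup>+p. k (fst p) * indicator {..v} (snd p) \<partial>M)"
    if [measurable]: "k \<in> borel_measurable borel" for k
    unfolding N_def
    by (subst nn_integral_distr, simp, simp, subst nn_integral_density) (auto simp: mult.commute)
  have le: "(\<integral>\<^sup>+x. k x \<partial>N) \<le> (\<integral>\<^sup>+x. k x * indicator {0..1} x \<partial>lborel)"
    if [measurable]: "k \<in> borel_measurable borel" for k
    unfolding N[OF that] nn_integral_fst[OF that, symmetric]
    by (intro nn_integral_mono) (auto simp: indicator_def)
  have "absolutely_continuous lborel N"
    unfolding absolutely_continuous_def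
  proof
    fix A :: "real set" assume A: "A \<in> null_sets lborel"
    then have [measurable]: "A \<in> sets borel" by auto
    have "emeasure N A \<le> (\<integral>\<^sup>+x. indicator A x * indicator {0..1} x \<partial>lborel)"
      using le[of "indicator A"] by (simp add: setsN)
    also have "\<dots> \<le> (\<integral>\<^sup>+x. indicator A x \<partial>lborel)"
      by (intro nn_integral_mono) (auto simp: indicator_def)
    also have "\<dots> = 0" using A by auto
    finally show "A \<in> null_sets N" by (simp add: null_sets_def setsN)
  qed
  from sigma_finite_measure.Radon_Nikodym[OF lborel.sigma_finite_measure_axioms this setsN]
  obtain h where [measurable]: "h \<in> borel_measurable lborel" and h: "density lborel h = N"
    by blast
  have Nh: "(\<integral>\<^sup>+x. k x \<partial>N) = (\<integral>\<^sup>+x. h x * k x \<partial>lborel)"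
    if [measurable]: "k \<in> borel_measurable borel" for k
    unfolding h[symmetric] by (rule nn_integral_density) measurable
  have "AE x in lborel. h x \<le> indicator {0..1} x"
  proof (rule AE_le_if_set_nn_integral_le)
    fix A :: "real set" assume "A \<in> sets lborel"
    then have [measurable]: "A \<in> sets borel" by simp
    show "(\<integral>\<^sup>+x. h x * indicator A x \<partial>lborel) \<le> (\<integral>\<^sup>+x. indicator {0..1} x * indicator A x \<partial>lborel)"
      using le[of "indicator A"] Nh[of "indicator A"] by (simp add: mult.commute)
  qed simp_all
  then have ae: "AE x in lborel. h x = ennreal (indicator {0..1} x * min 1 (enn2real (h x)))"
  proof eventually_elim
    case (elim x)
    then have "h x \<le> 1" "x \<notin> {0..1} \<Longrightarrow> h x = 0"
      by (auto simp: indicator_def split: if_splits intro: order_trans)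
    moreover from this(1) have "ennreal (min 1 (enn2real (h x))) = h x"
      by (cases "h x") (auto simp: min_def top_unique)
    ultimately show ?case
      by (auto simp: indicator_def)
  qed
  show ?thesis
  proof (intro bexI conjI allI ballI)
    let ?f = "\<lambda>x. indicator {0..1} x * min 1 (enn2real (h x))"
    show "0 \<le> ?f x" "?f x \<le> indicator {0..1} x" for x
      by (auto simp: indicator_def)
    fix k :: "real \<Rightarrow> ennreal" assume [measurable]: "k \<in> borel_measurable borel"
    have "(\<integral>\<^sup>+p. k (fst p) * indicator {..v} (snd p) \<partial>M) = (\<integral>\<^sup>+x. h x * k x \<partial>lborel)"
      by (simp add: N[symmetric] Nh)
    also have "\<dots> = (\<integral>\<^sup>+x. k x * ennreal (?f x) \<partial>lborel)"
      by (intro nn_integral_cong_AE) (use ae in eventually_elim, simp add: mult.commute)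
    finally show "(\<integral>\<^sup>+p. k (fst p) * indicator {..v} (snd p) \<partial>M) = (\<integral>\<^sup>+x. k x * ennreal (?f x) \<partial>lborel)" .
  qed measurable
qed

text \<open>
  A Borel version of \<open>\<lambda>x. partial1 C x v\<close> with values in \<open>{0..1}\<close> everywhere. Working with it
  avoids the unspecified values of the derivative and the question of its measurability.
\<close>

definition dens :: "real \<Rightarrow> real \<Rightarrow> real" where
  "dens v = (SOME f. f \<in> borel_measurable borel \<and> (\<forall>x. 0 \<le> f x \<and> f x \<le> indicator {0..1} x) \<and>
     (\<forall>k \<in> borel_measurable borel.
        (\<integral>\<^sup>+p. k (fst p) * indicator {..v} (snd p) \<partial>M) = (\<integral>\<^sup>+x. k x * ennreal (f x) \<partial>lborel)))"

lemma dens_measurable [measurable]: "dens v \<in> borel_measurable borel"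
  and dens_nonneg [simp]: "0 \<le> dens v x"
  and dens_le_indicator: "dens v x \<le> indicator {0..1} x"
  and nn_integral_dens: "k \<in> borel_measurable borel \<Longrightarrow>
    (\<integral>\<^sup>+p. k (fst p) * indicator {..v} (snd p) \<partial>M) = (\<integral>\<^sup>+x. k x * ennreal (dens v x) \<partial>lborel)"
  using someI_ex[OF section_density_exists[of v, unfolded Bex_def], folded dens_def] by auto

lemma dens_le_1 [simp]: "dens v x \<le> 1"
  by (rule order_trans[OF dens_le_indicator]) (simp add: indicator_def)

lemma dens_outside: "x \<notin> {0..1} \<Longrightarrow> dens v x = 0"
  using dens_le_indicator[of v x] dens_nonneg[of v x] by (auto simp: indicator_def simp del: dens_nonneg)

lemma integrable_dens_mult:
  assumes [measurable]: "k \<in> borel_measurable borel" and "\<And>x. \<bar>k x\<bar> \<le> 1"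
  shows "integrable lborel (\<lambda>x. k x * dens v x)"
proof (rule Bochner_Integration.integrable_bound)
  show "integrable lborel (indicator {0..1::real} :: real \<Rightarrow> real)"
    by simp
  show "AE x in lborel. norm (k x * dens v x) \<le> norm (indicator {0..1} x :: real)"
  proof (rule AE_I2)
    fix x
    have "\<bar>k x\<bar> * dens v x \<le> 1 * indicator {0..1} x"
      using assms(2) by (intro mult_mono dens_le_indicator) auto
    then show "norm (k x * dens v x) \<le> norm (indicator {0..1} x :: real)"
      by (simp add: abs_mult)
  qed
qed measurable

lemma integrable_dens: "integrable lborel (dens v)"
  using integrable_dens_mult[of "\<lambda>_. 1" v] by simp

lemma C_eq_integral:
  assumes "u \<in> {0..1}" "v \<in> {0..1}"
  shows "C u v = (LINT x|lborel. indicator {..u} x * dens v x)"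
proof -
  have "emeasure M ({..u} \<times> {..v}) = (\<integral>\<^sup>+p. indicator ({..u} \<times> {..v}) p \<partial>M)"
    by (subst nn_integral_indicator) (auto simp: sets_M borel_Times)
  also have "\<dots> = (\<integral>\<^sup>+x. indicator {..u} x * ennreal (dens v x) \<partial>lborel)"
    unfolding indicator_times_mult by (subst nn_integral_dens) auto
  also have "\<dots> = (\<integral>\<^sup>+x. ennreal (indicator {..u} x * dens v x) \<partial>lborel)"
    by (intro nn_integral_cong) (auto simp: indicator_def)
  also have "\<dots> = ennreal (LINT x|lborel. indicator {..u} x * dens v x)"
    by (intro nn_integral_eq_integral integrable_dens_mult) (auto simp: indicator_def)
  finally show ?thesis
    using assms by (simp add: C_eq measure_def)
qed

lemma has_integral_dens:
  assumes "u \<in> {0..1}" "v \<in> {0..1}"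
  shows "(dens v has_integral C u v) {0..u}"
proof -
  have "((\<lambda>x. indicator {..u} x * dens v x) has_integral C u v) UNIV"
    unfolding C_eq_integral[OF assms]
    by (intro has_integral_integral_lborel integrable_dens_mult) (auto simp: indicator_def)
  also have "(\<lambda>x. indicator {..u} x * dens v x) = (\<lambda>x. if x \<in> {0..u} then dens v x else 0)"
    using assms dens_outside[of _ v] by (auto simp: fun_eq_iff indicator_def)
  finally show ?thesis
    by (simp only: has_integral_restrict_UNIV)
qed

lemma partial1_eq_dens:
  assumes v: "v \<in> {0..1}"
  obtains N where "negligible N"
    and "\<And>x. x \<in> {0..1} - N \<Longrightarrow> x \<in> {0<..<1}"
    and "\<And>x. x \<in> {0..1} - N \<Longrightarrow> ((\<lambda>u. C u v) has_real_derivative dens v x) (at x)"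
    and "\<And>x. x \<in> {0..1} - N \<Longrightarrow> partial1 C x v = dens v x"
proof -
  have "dens v integrable_on {0..1}" using has_integral_dens[of 1 v] v by auto
  then obtain N where N: "negligible N" "\<And>x. x \<in> {0<..<1} - N \<Longrightarrow>
     ((\<lambda>u. integral {0..u} (dens v)) has_real_derivative dens v x) (at x)"
    using AE_has_real_derivative_integral by metis
  have D: "((\<lambda>u. C u v) has_real_derivative dens v x) (at x)" if x: "x \<in> {0<..<1} - N" for x
  proof (rule has_field_derivative_transform_within_open[OF N(2)[OF x]])
    show "integral {0..u} (dens v) = C u v" if "u \<in> {0<..<1}" for u
      using that v by (intro integral_unique has_integral_dens) auto
  qed (use x in auto)
  show thesis
  proof
    show "negligible (N \<union> {0, 1})" using N(1) by (simp add: negligible_Un)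
    fix x assume x: "x \<in> {0..1} - (N \<union> {0, 1})"
    then show "x \<in> {0<..<1}" by auto
    with x show "((\<lambda>u. C u v) has_real_derivative dens v x) (at x)" by (intro D) auto
    then show "partial1 C x v = dens v x" unfolding partial1_def by (rule DERIV_imp_deriv)
  qed
qed

text \<open>
  The exceptional null set depends on \<open>v\<close> and \<open>w\<close>, so this does not make \<open>\<lambda>v. dens v x\<close> a
  distribution function for almost every \<open>x\<close>.
\<close>

lemma AE_dens_mono:
  assumes "v \<le> w"
  shows "AE x in lborel. dens v x \<le> dens w x"
proof -
  have "AE x in lborel. ennreal (dens v x) \<le> ennreal (dens w x)"
  proof (rule AE_le_if_set_nn_integral_le)
    fix A :: "real set" assume "A \<in> sets lborel"
    then have [measurable]: "A \<in> sets borel" by simp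
    have "(\<integral>\<^sup>+p. indicator A (fst p) * indicator {..v} (snd p) \<partial>M)
        \<le> (\<integral>\<^sup>+p. indicator A (fst p) * indicator {..w} (snd p) \<partial>M)"
      using assms by (intro nn_integral_mono) (auto simp: indicator_def)
    then show "(\<integral>\<^sup>+x. ennreal (dens v x) * indicator A x \<partial>lborel)
        \<le> (\<integral>\<^sup>+x. ennreal (dens w x) * indicator A x \<partial>lborel)"
      by (simp add: nn_integral_dens mult.commute)
  next
    show "(\<integral>\<^sup>+x. ennreal (dens w x) \<partial>lborel) \<noteq> \<infinity>"
      by (simp add: nn_integral_eq_integral[OF integrable_dens])
  qed measurable
  then show ?thesis by simp
qed

lemma AE_in_unit_square: "AE p in M. fst p \<in> {0..1} \<and> snd p \<in> {0..1}"
proof -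
  have *: "AE x in uniform_measure lborel {0..1::real}. x \<in> {0..1}"
    by (rule AE_uniform_measureI) auto
  have "AE p in M. fst p \<in> {0..1}" "AE p in M. snd p \<in> {0..1}"
    using *[folded fst_M] *[folded snd_M] by (simp_all add: AE_distr_iff)
  then show ?thesis by eventually_elim simp
qed

lemma C_1_left:
  assumes "v \<in> {0..1}"
  shows "C 1 v = v"
proof -
  have "C 1 v = measure M (UNIV \<times> {..v})"
    unfolding C_eq[OF _ assms, of 1, simplified]
  proof (rule finite_measure_eq_AE)
    show "AE p in M. p \<in> {..1} \<times> {..v} \<longleftrightarrow> p \<in> UNIV \<times> {..v}"
      using AE_in_unit_square by (rule eventually_mono) auto
  qed (auto simp: sets_M borel_Times)
  also have "UNIV \<times> {..v} = snd -` {..v} \<inter> space M"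
    by (auto simp: space_M)
  also have "measure M \<dots> = measure (uniform_measure lborel {0..1}) {..v}"
    unfolding snd_M[symmetric] by (subst measure_distr) auto
  also have "\<dots> = v"
    using assms by (simp add: measure_uniform_unit_atMost)
  finally show ?thesis .
qed

lemma LINT_dens: "v \<in> {0..1} \<Longrightarrow> (LINT x|lborel. dens v x) = v"
  using C_eq_integral[of 1 v] dens_outside[of _ v]
  by (subst C_1_left[symmetric]) (auto intro!: Bochner_Integration.integral_cong simp: indicator_def)

end

section \<open>The Markov product as a distribution function\<close>

text \<open>
  For the product, \<open>swap.dens u t\<close> represents the derivative of \<open>C1 u\<close> at \<open>t\<close> (the density
  of the transposed copula) and \<open>two.dens v t\<close> the derivative of \<open>\<lambda>t. C2 t v\<close>.
\<close>

locale copula_pair = one: copula_law M1 C1 + two: copula_law M2 C2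
  for M1 C1 M2 C2
begin

sublocale swap: copula_law "distr M1 borel prod.swap" "\<lambda>u v. C1 v u"
  by (rule one.transpose)

abbreviation "D \<equiv> markov_product C1 C2"

lemma integrable_product: "integrable lborel (\<lambda>t. swap.dens u t * two.dens v t)"
  by (rule two.integrable_dens_mult) auto

lemma markov_product_eq_LINT:
  assumes "u \<in> {0..1}" "v \<in> {0..1}"
  shows "D u v = (LINT t|lborel. swap.dens u t * two.dens v t)"
proof -
  let ?h = "\<lambda>t. swap.dens u t * two.dens v t"
  let ?k = "\<lambda>t. partial2 C1 u t * partial1 C2 t v"
  obtain N1 where N1: "negligible N1"
    "\<And>t. t \<in> {0..1} - N1 \<Longrightarrow> partial1 (\<lambda>u v. C1 v u) t u = swap.dens u t"
    using swap.partial1_eq_dens[OF assms(1)] by metis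
  obtain N2 where N2: "negligible N2" "\<And>t. t \<in> {0..1} - N2 \<Longrightarrow> partial1 C2 t v = two.dens v t"
    using two.partial1_eq_dens[OF assms(2)] by metis
  have kh: "?k t = ?h t" if "t \<in> {0..1} - (N1 \<union> N2)" for t
    using N1(2)[of t] N2(2)[of t] that by (auto simp: partial1_def partial2_def)
  have neg: "negligible (N1 \<union> N2)" using N1(1) N2(1) by simp
  have ind: "indicator {0..1} t *\<^sub>R ?h t = ?h t" for t
    using two.dens_outside[of t v] by (auto simp: indicator_def)
  have h: "set_integrable lebesgue {0..1} ?h"
    unfolding set_integrable_def ind by (subst integrable_completion) (auto simp: integrable_product)
  have "D u v = integral {0..1} ?k"
    unfolding markov_product_def
    by (rule set_lebesgue_integral_eq_integral(2)) (rule absolutely_integrable_spike[OF h neg kh])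
  also have "\<dots> = integral {0..1} ?h"
    by (rule integral_spike[OF neg]) (use kh in auto)
  also have "\<dots> = (LINT t:{0..1}|lebesgue. ?h t)"
    by (rule set_lebesgue_integral_eq_integral(2)[OF h, symmetric])
  also have "\<dots> = (LINT t|lborel. ?h t)"
    unfolding set_lebesgue_integral_def ind by (rule integral_completion) simp
  finally show ?thesis .
qed

lemma nn_integral_swap_dens:
  assumes [measurable]: "k \<in> borel_measurable borel"
  shows "(\<integral>\<^sup>+p. indicator {..u} (fst p) * k (snd p) \<partial>M1)
       = (\<integral>\<^sup>+t. ennreal (swap.dens u t) * k t \<partial>lborel)"
proof -
  have [measurable]: "prod.swap \<in> measurable M1 (borel :: (real \<times> real) measure)"
    unfolding borel_prod[symmetric] prod.swap_def by measurable
  have [measurable]: "fst \<in> measurable (borel :: (real \<times> real) measure) borel"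
    "snd \<in> measurable (borel :: (real \<times> real) measure) borel"
    unfolding borel_prod[symmetric] by measurable
  have "(\<integral>\<^sup>+p. indicator {..u} (fst p) * k (snd p) \<partial>M1)
      = (\<integral>\<^sup>+p. k (fst p) * indicator {..u} (snd p) \<partial>distr M1 borel prod.swap)"
    by (subst nn_integral_distr) (auto simp: mult.commute)
  also have "\<dots> = (\<integral>\<^sup>+t. ennreal (swap.dens u t) * k t \<partial>lborel)"
    by (subst swap.nn_integral_dens) (auto simp: mult.commute)
  finally show ?thesis .
qed

lemma has_integral_markov_product:
  assumes "u \<in> {0..1}" "v \<in> {0..1}"
  shows "((\<lambda>t. swap.dens u t * two.dens v t) has_integral D u v) {0..1}"
proof -
  have "((\<lambda>t. swap.dens u t * two.dens v t) has_integral D u v) UNIV"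
    unfolding markov_product_eq_LINT[OF assms]
    by (rule has_integral_integral_lborel[OF integrable_product])
  also have "(\<lambda>t. swap.dens u t * two.dens v t)
      = (\<lambda>t. if t \<in> {0..1} then swap.dens u t * two.dens v t else 0)"
    using two.dens_outside[of _ v] by auto
  finally show ?thesis
    by (simp only: has_integral_restrict_UNIV)
qed

text \<open>
  Both bounds come from \<open>0 \<le> swap.dens u \<le> 1\<close> and from the fact that the increment
  \<open>two.dens w - two.dens v\<close> is almost everywhere nonnegative with integral \<open>w - v\<close>.
\<close>

lemma D_mono_Lipschitz:
  assumes "u \<in> {0..1}" "0 \<le> v" "v \<le> w" "w \<le> 1"
  shows "D u v \<le> D u w" "D u w \<le> D u v + (w - v)"
proof -
  have "D u w - D u v = (LINT t|lborel. swap.dens u t * (two.dens w t - two.dens v t))"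
    using assms by (simp add: markov_product_eq_LINT integrable_product right_diff_distrib)
  moreover have "(LINT t|lborel. two.dens w t - two.dens v t) = w - v"
    using assms by (simp add: two.integrable_dens two.LINT_dens)
  moreover have "AE t in lborel. 0 \<le> two.dens w t - two.dens v t"
    using two.AE_dens_mono[OF assms(3)] by eventually_elim simp
  ultimately show "D u v \<le> D u w" "D u w \<le> D u v + (w - v)"
    using LINT_product_bounds[of "swap.dens u" "\<lambda>t. two.dens w t - two.dens v t"]
    by (auto simp: two.integrable_dens)
qed

text \<open>
  The density \<open>two.dens 1\<close> is at most the indicator of the unit interval and has the same integral,
  so replacing it by the indicator does not change the product.
\<close>

lemma D_1_right:
  assumes "u \<in> {0..1}"
  shows "D u 1 = u"
proof -
  let ?h = "\<lambda>t. indicator {0..1} t - two.dens 1 t"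
  have "integrable lborel ?h"
    by (intro Bochner_Integration.integrable_diff two.integrable_dens) simp
  moreover have "(LINT t|lborel. ?h t) = 0"
    by (simp add: two.integrable_dens two.LINT_dens)
  moreover have "AE t in lborel. 0 \<le> ?h t"
    using two.dens_le_indicator[of 1] by simp
  moreover have "(LINT t|lborel. swap.dens u t * ?h t) = u - D u 1"
  proof -
    have "swap.dens u t * ?h t = swap.dens u t - swap.dens u t * two.dens 1 t" for t
      using swap.dens_outside[of t u] by (auto simp: indicator_def algebra_simps)
    then show ?thesis
      using assms by (simp add: markov_product_eq_LINT integrable_product swap.integrable_dens swap.LINT_dens)
  qed
  ultimately show ?thesis
    using LINT_product_bounds[of "swap.dens u" ?h] by auto
qed

lemma D_1_left:
  assumes "v \<in> {0..1}"
  shows "D 1 v = v"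
proof -
  let ?h = "\<lambda>t. indicator {0..1} t - swap.dens 1 t"
  have "integrable lborel ?h"
    by (intro Bochner_Integration.integrable_diff swap.integrable_dens) simp
  moreover have "(LINT t|lborel. ?h t) = 0"
    by (simp add: swap.integrable_dens swap.LINT_dens)
  moreover have "AE t in lborel. 0 \<le> ?h t"
    using swap.dens_le_indicator[of 1] by simp
  moreover have "(LINT t|lborel. two.dens v t * ?h t) = v - D 1 v"
  proof -
    have "two.dens v t * ?h t = two.dens v t - swap.dens 1 t * two.dens v t" for t
      using two.dens_outside[of t v] by (auto simp: indicator_def algebra_simps)
    then show ?thesis
      using assms by (simp add: markov_product_eq_LINT integrable_product two.integrable_dens two.LINT_dens)
  qed
  ultimately show ?thesis
    using LINT_product_bounds[of "two.dens v" ?h] by auto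
qed

text \<open>
  The generalized inverse of \<open>\<lambda>v. two.dens v t\<close>: applied to a uniform \<open>w\<close>, it samples the second
  coordinate of \<open>M2\<close> conditionally on the first coordinate being \<open>t\<close>. Only rational levels enter,
  which makes it measurable and lets countably many null sets be discarded at once; the value 1
  is a cap for those \<open>w\<close> that no level reaches.
\<close>

definition quant :: "real \<Rightarrow> real \<Rightarrow> real" where
  "quant t w = (INF q\<in>\<rat> \<inter> {0..1}. if w \<le> two.dens q t then q else 1)"

lemma quant_bdd: "bdd_below ((\<lambda>q. if w \<le> two.dens q t then q else 1) ` (\<rat> \<inter> {0..1}))"
  by (rule bdd_belowI[of _ 0]) auto

lemma quant_le: "q \<in> \<rat> \<inter> {0..1} \<Longrightarrow> w \<le> two.dens q t \<Longrightarrow> quant t w \<le> q"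
  unfolding quant_def by (rule cINF_lower2[OF quant_bdd]) auto

lemma quant_nonneg: "0 \<le> quant t w"
  unfolding quant_def by (rule cINF_greatest) (auto intro!: exI[of _ 0])

lemma quant_le_1: "quant t w \<le> 1"
  unfolding quant_def by (rule order_trans[OF cINF_lower[OF quant_bdd, of 1]]) auto

lemma quant_less_iff:
  assumes "v \<le> 1"
  shows "quant t w < v \<longleftrightarrow> (\<exists>q\<in>\<rat> \<inter> {0..1}. q < v \<and> w \<le> two.dens q t)"
proof -
  have "\<rat> \<inter> {0..1::real} \<noteq> {}" by auto
  then show ?thesis
    unfolding quant_def using assms by (subst cINF_less_iff[OF _ quant_bdd]) (auto split: if_splits)
qed

lemma quant_measurable [measurable]:
  assumes [measurable]: "f \<in> borel_measurable N" "g \<in> borel_measurable N"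
  shows "(\<lambda>x. quant (f x) (g x)) \<in> borel_measurable N"
  unfolding quant_def
  by (rule borel_measurable_cINF_real) (auto intro: countable_subset[OF _ countable_rat])

text \<open>
  Under \<open>glue\<close> a point has the form \<open>((u, t), w)\<close>, where \<open>(u, t)\<close> has law \<open>M1\<close> and \<open>w\<close> is an
  independent uniform variable. The vector \<open>(u, quant t w)\<close> then joins the two laws
  along their common coordinate \<open>t\<close> in a conditionally independent way, and turns out to have
  the Markov product as its distribution function.
\<close>

definition "unif = uniform_measure lborel {0..1::real}"
definition "glue = M1 \<Otimes>\<^sub>M unif"

lemma sets_unif [measurable_cong]: "sets unif = sets borel" by (simp add: unif_def)

sublocale unif: prob_space unif
  unfolding unif_def by (rule prob_space_uniform_unit)
sublocale glue: prob_space glue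
  unfolding glue_def by (rule prob_space_pair) (rule one.prob_space_axioms, rule unif.prob_space_axioms)

lemma sets_glue [measurable_cong]: "sets glue = sets ((borel \<Otimes>\<^sub>M borel) \<Otimes>\<^sub>M borel)"
  unfolding glue_def by (rule sets_pair_measure_cong) (simp_all add: one.sets_M_prod sets_unif)

lemma space_glue: "space glue = UNIV"
  using sets_eq_imp_space_eq[OF sets_glue] by (simp add: space_pair_measure)

lemma Collect_in_sets_glue: "Measurable.pred glue Q \<Longrightarrow> {x. Q x} \<in> sets glue"
  by (simp add: pred_def space_glue)

lemma distr_glue_fst: "distr glue M1 fst = M1"
  unfolding glue_def by (rule unif.distr_pair_fst)

text \<open>
  The coordinate \<open>t\<close> is uniformly distributed, so Lebesgue null sets may be ignored.
\<close>

lemma AE_glue: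
  assumes "AE t in lborel. Q t"
  shows "AE x in glue. Q (snd (fst x))"
proof -
  have "AE t in uniform_measure lborel {0..1}. Q t"
    by (rule AE_uniform_measureI) (use assms in \<open>auto elim: eventually_mono\<close>)
  then have "AE p in M1. Q (snd p)"
    unfolding one.snd_M[symmetric] by (rule AE_distrD[rotated]) measurable
  then have "AE p in distr glue M1 fst. Q (snd p)"
    unfolding distr_glue_fst .
  then show ?thesis
    by (rule AE_distrD[rotated]) (simp add: glue_def)
qed

lemma measure_glue_below_dens:
  assumes "u \<in> {0..1}" "q \<in> {0..1}"
  shows "measure glue {x. fst (fst x) \<le> u \<and> snd x \<le> two.dens q (snd (fst x))} = D u q"
    (is "measure glue ?E = _")
proof -
  have E: "?E \<in> sets glue"
    by (rule Collect_in_sets_glue) measurable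
  have slice: "emeasure unif (Pair p -` ?E) = indicator {..u} (fst p) * ennreal (two.dens q (snd p))" for p
  proof -
    have "Pair p -` ?E = (if fst p \<le> u then {..two.dens q (snd p)} else {})" by auto
    then show ?thesis
      by (simp add: unif.emeasure_eq_measure) (simp add: unif_def measure_uniform_unit_atMost)
  qed
  have "emeasure glue ?E = (\<integral>\<^sup>+p. emeasure unif (Pair p -` ?E) \<partial>M1)"
    unfolding glue_def by (rule unif.emeasure_pair_measure_alt) (use E in \<open>simp add: glue_def\<close>)
  also have "\<dots> = (\<integral>\<^sup>+p. indicator {..u} (fst p) * ennreal (two.dens q (snd p)) \<partial>M1)"
    unfolding slice ..
  also have "\<dots> = (\<integral>\<^sup>+t. ennreal (swap.dens u t * two.dens q t) \<partial>lborel)"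
    by (subst nn_integral_swap_dens) (simp_all add: ennreal_mult)
  also have "\<dots> = ennreal (D u q)"
    unfolding markov_product_eq_LINT[OF assms]
    by (rule nn_integral_eq_integral[OF integrable_product]) simp
  finally show ?thesis
    using D_mono_Lipschitz(1)[OF assms(1), of 0 q] assms
      LINT_product_bounds(1)[of "swap.dens u" "two.dens q"] markov_product_eq_LINT[OF assms]
    by (simp add: measure_def two.integrable_dens)
qed

text \<open>
  Up to null sets, the event \<open>quant t w \<le> v\<close> lies between the events \<open>w \<le> two.dens q t\<close> for rational
  \<open>q \<le> v\<close> and the events \<open>w \<le> two.dens w' t\<close> for \<open>w' > v\<close>. Intersected with the event that
  the first coordinate is at most \<open>u\<close>, the former have probabilities \<open>D u q\<close> and the latter
  \<open>D u w'\<close>, and \<open>D u\<close> is Lipschitz.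
\<close>

lemma measure_glue_quant:
  assumes u: "u \<in> {0..1}" and v: "v \<in> {0..1}"
  shows "measure glue {x. fst (fst x) \<le> u \<and> quant (snd (fst x)) (snd x) \<le> v} = D u v"
    (is "measure glue ?F = _")
proof (rule antisym)
  have F[measurable]: "?F \<in> sets glue"
    by (rule Collect_in_sets_glue) measurable
  have E[measurable]: "{x. fst (fst x) \<le> u \<and> snd x \<le> two.dens q (snd (fst x))} \<in> sets glue" for q
    by (rule Collect_in_sets_glue) measurable
  show "measure glue ?F \<le> D u v"
  \<comment> \<open>For \<open>v = 1\<close> there is no level above \<open>v\<close>; the marginal condition takes over.\<close>
  proof (cases "v = 1")
    case True
    have "measure glue ?F \<le> measure glue {x. fst (fst x) \<le> u}"
      by (rule glue.finite_measure_mono) (auto intro!: Collect_in_sets_glue)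
    also have "{x. fst (fst x) \<le> u} = fst -` ({..u} \<times> UNIV) \<inter> space glue"
      by (auto simp: space_glue)
    also have "measure glue \<dots> = measure (distr glue M1 fst) ({..u} \<times> UNIV)"
      by (subst measure_distr) (auto simp: glue_def one.sets_M_prod)
    also have "\<dots> = measure M1 (fst -` {..u} \<inter> space M1)"
      unfolding distr_glue_fst by (rule arg_cong[where f = "measure M1"]) (auto simp: one.space_M)
    also have "\<dots> = measure (uniform_measure lborel {0..1}) {..u}"
      unfolding one.fst_M[symmetric] by (subst measure_distr) auto
    also have "\<dots> = D u v"
      using u True by (simp add: D_1_right measure_uniform_unit_atMost)
    finally show ?thesis .
  next
    case False
    show ?thesis
    proof (rule field_le_epsilon)
      fix e :: real assume e: "e > 0"
      define w where "w = min 1 (v + e)"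
      have w: "v < w" "w \<le> 1" "w - v \<le> e" "w \<in> {0..1}"
        using e v False by (auto simp: w_def min_def)
      have "AE t in lborel. \<forall>q \<in> \<rat> \<inter> {0..<w}. two.dens q t \<le> two.dens w t"
        by (subst AE_ball_countable)
          (auto intro: two.AE_dens_mono countable_subset[OF _ countable_rat])
      from AE_glue[OF this]
      have "AE x in glue. x \<in> ?F \<longrightarrow> x \<in> {x. fst (fst x) \<le> u \<and> snd x \<le> two.dens w (snd (fst x))}"
      proof eventually_elim
        case (elim x)
        show ?case
        proof
          assume x: "x \<in> ?F"
          then have "quant (snd (fst x)) (snd x) < w" using w by auto
          then obtain q where "q \<in> \<rat> \<inter> {0..1}" "q < w" "snd x \<le> two.dens q (snd (fst x))"
            unfolding quant_less_iff[OF w(2)] by auto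
          with elim x show "x \<in> {x. fst (fst x) \<le> u \<and> snd x \<le> two.dens w (snd (fst x))}"
            by (auto intro: order_trans)
        qed
      qed
      then have "measure glue ?F \<le> D u w"
        unfolding measure_glue_below_dens[OF u w(4), symmetric]
        by (rule glue.finite_measure_mono_AE) measurable
      also have "\<dots> \<le> D u v + e"
        using D_mono_Lipschitz(2)[OF u, of v w] w v by auto
      finally show "measure glue ?F \<le> D u v + e" .
    qed
  qed
  show "D u v \<le> measure glue ?F"
  proof (rule field_le_epsilon)
    fix e :: real assume e: "e > 0"
    obtain q where q: "q \<in> \<rat>" "q \<le> v" "0 \<le> q" "v - q \<le> e"
    proof (cases "v = 0")
      case True
      then show thesis using that[of 0] e by auto
    next
      case False
      then have "max 0 (v - e) < v" using v e by auto
      then obtain q where "q \<in> \<rat>" "max 0 (v - e) < q" "q < v"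
        using Rats_dense_in_real by blast
      then show thesis using that[of q] by auto
    qed
    have "D u v \<le> D u q + e"
      using D_mono_Lipschitz(2)[OF u, of q v] q v by auto
    also have "D u q = measure glue {x. fst (fst x) \<le> u \<and> snd x \<le> two.dens q (snd (fst x))}"
      using q v by (intro measure_glue_below_dens[symmetric] u) auto
    also have "\<dots> \<le> measure glue ?F"
      by (rule glue.finite_measure_mono) (use q v in \<open>auto intro!: quant_le[THEN order_trans]\<close>)
    finally show "D u v \<le> measure glue ?F + e" by simp
  qed
qed

lemma copula2_markov_product: "copula2 D"
proof -
  define X where "X = (\<lambda>x :: (real \<times> real) \<times> real. (fst (fst x), quant (snd (fst x)) (snd x)))"
  have X[measurable]: "X \<in> measurable glue borel"
    unfolding X_def borel_prod[symmetric] by measurable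
  have [measurable]: "fst \<in> measurable (borel :: (real \<times> real) measure) borel"
    "snd \<in> measurable (borel :: (real \<times> real) measure) borel"
    unfolding borel_prod[symmetric] by measurable
  have "distr (distr glue borel X) borel fst = distr (distr glue M1 fst) borel fst"
    by (subst (1 2) distr_distr) (auto simp: comp_def X_def glue_def)
  also have "\<dots> = uniform_measure lborel {0..1}"
    unfolding distr_glue_fst by (rule one.fst_M)
  finally have margin1: "distr (distr glue borel X) borel fst = uniform_measure lborel {0..1}" .
  have AE1: "AE x in glue. fst (fst x) \<le> 1"
  proof -
    have "AE p in distr glue M1 fst. fst p \<le> 1"
      unfolding distr_glue_fst using one.AE_in_unit_square by eventually_elim simp
    then show ?thesis by (rule AE_distrD[rotated]) (simp add: glue_def)
  qed
  have measure_quant: "measure glue {x. quant (snd (fst x)) (snd x) \<le> v} = min 1 (max 0 v)" for v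
  proof -
    consider "v < 0" | "v \<in> {0..1}" | "v > 1" by fastforce
    then show ?thesis
    proof cases
      case 1
      then have "{x. quant (snd (fst x)) (snd x) \<le> v} = {}"
        using quant_nonneg by (auto simp: not_le intro: less_le_trans)
      then show ?thesis using 1 by simp
    next
      case 2
      have "measure glue {x. quant (snd (fst x)) (snd x) \<le> v}
          = measure glue {x. fst (fst x) \<le> 1 \<and> quant (snd (fst x)) (snd x) \<le> v}"
        by (rule glue.finite_measure_eq_AE) (use AE1 in \<open>auto elim!: eventually_mono intro!: Collect_in_sets_glue\<close>)
      then show ?thesis
        using 2 by (simp add: measure_glue_quant D_1_left)
    next
      case 3
      then have "{x. quant (snd (fst x)) (snd x) \<le> v} = space glue"
        by (auto simp: space_glue intro: order_trans[OF quant_le_1])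
      then show ?thesis using 3 by (simp add: glue.prob_space)
    qed
  qed
  have margin2: "distr (distr glue borel X) borel snd = uniform_measure lborel {0..1}"
  proof (rule cdf_unique)
    have "distr (distr glue borel X) borel snd = distr glue borel (\<lambda>x. quant (snd (fst x)) (snd x))"
      by (subst distr_distr) (auto simp: comp_def X_def)
    moreover have "cdf (distr glue borel (\<lambda>x. quant (snd (fst x)) (snd x))) v = min 1 (max 0 v)" for v
      unfolding cdf_def by (subst measure_distr) (auto simp: space_glue vimage_def measure_quant)
    ultimately show "cdf (distr (distr glue borel X) borel snd) = cdf (uniform_measure lborel {0..1})"
      by (simp add: fun_eq_iff cdf_def measure_uniform_unit_atMost)
    show "real_distribution (distr (distr glue borel X) borel snd)"
      by (intro real_distribution.intro prob_space.prob_space_distr glue.prob_space_distr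
          real_distribution_axioms.intro) auto
    show "real_distribution (uniform_measure lborel {0..1})"
      by (intro real_distribution.intro prob_space_uniform_unit real_distribution_axioms.intro) auto
  qed
  have "D u v = measure (distr glue borel X) ({..u} \<times> {..v})" if "u \<in> {0..1}" "v \<in> {0..1}" for u v
    unfolding measure_glue_quant[OF that, symmetric]
    by (subst measure_distr) (auto simp: X_def space_glue borel_Times intro!: arg_cong[where f = "measure glue"])
  then show ?thesis
    unfolding copula2_def using margin1 margin2
    by (intro exI[of _ "distr glue borel X"]) (simp add: glue.prob_space_distr)
qed

end

section \<open>Stochastic monotonicity of the Markov product\<close>

text \<open>
  The signs \<open>1\<close> and \<open>-1\<close> stand for stochastically decreasing and stochastically increasing. They turn
  the four cases of the product rule into the single statement that the signs \<open>s1\<close> and \<open>s2\<close>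
  produce the sign \<open>- (s1 * s2)\<close>.
\<close>

definition stoch_monotone_sign :: "real \<Rightarrow> (real \<Rightarrow> real \<Rightarrow> real) \<Rightarrow> bool" where
  "stoch_monotone_sign s C \<longleftrightarrow>
     (\<forall>v\<in>{0..1}. \<exists>g :: real \<Rightarrow> real.
        mono_on {0..1} g \<and> (AE u in lebesgue_on {0..1}. partial1 C u v = s * g u))"

lemma stoch_decreasing1_iff_sign: "stoch_decreasing1 C \<longleftrightarrow> stoch_monotone_sign 1 C"
  by (simp add: stoch_decreasing1_def stoch_monotone_sign_def)

lemma stoch_increasing1_iff_sign: "stoch_increasing1 C \<longleftrightarrow> stoch_monotone_sign (-1) C"
proof -
  have "(\<exists>g :: real \<Rightarrow> real. antimono_on {0..1} g \<and> Q g) \<longleftrightarrow>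
        (\<exists>g :: real \<Rightarrow> real. mono_on {0..1} g \<and> Q (\<lambda>u. - g u))" for Q
  proof
    assume "\<exists>g. antimono_on {0..1} g \<and> Q g"
    then obtain g where "antimono_on {0..1} g" "Q g" by blast
    then show "\<exists>g. mono_on {0..1} g \<and> Q (\<lambda>u. - g u)"
      by (intro exI[of _ "\<lambda>u. - g u"]) (auto simp: monotone_on_def)
  next
    assume "\<exists>g. mono_on {0..1} g \<and> Q (\<lambda>u. - g u)"
    then obtain g where "mono_on {0..1} g" "Q (\<lambda>u. - g u)" by blast
    then show "\<exists>g. antimono_on {0..1} g \<and> Q g"
      by (intro exI[of _ "\<lambda>u. - g u"]) (auto simp: monotone_on_def)
  qed
  from this[of "\<lambda>g. AE u in lebesgue_on {0..1}. partial1 C u _ = g u"]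
  show ?thesis
    by (simp add: stoch_increasing1_def stoch_monotone_sign_def)
qed

context copula_law
begin

lemma dens_eq_if_partial1_eq:
  assumes v: "v \<in> {0..1}" and g: "AE u in lebesgue_on {0..1}. partial1 C u v = g u"
  obtains N where "negligible N" "\<And>u. u \<in> {0..1} - N \<Longrightarrow> dens v u = g u"
proof -
  obtain N where N: "negligible N" "\<And>x. x \<in> {0..1} - N \<Longrightarrow> partial1 C x v = dens v x"
    using partial1_eq_dens[OF v] by metis
  have "negligible {u \<in> {0..1}. partial1 C u v \<noteq> g u}"
    using g by (subst (asm) AE_lebesgue_on_iff_negligible) auto
  with N(1) have "negligible (N \<union> {u \<in> {0..1}. partial1 C u v \<noteq> g u})" by simp
  moreover have "dens v u = g u" if "u \<in> {0..1} - (N \<union> {u \<in> {0..1}. partial1 C u v \<noteq> g u})" for u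
    using N(2)[of u] that by auto
  ultimately show thesis by (rule that)
qed

text \<open>
  The passage between the almost-everywhere formulation and convexity of the sections: a copula is
  the integral of its partial derivative, and conversely the derivative of a convex section is
  monotone where it exists.
\<close>

lemma stoch_monotone_sign_iff_convex:
  assumes s: "s * s = 1"
  shows "stoch_monotone_sign s C \<longleftrightarrow> (\<forall>v\<in>{0..1}. convex_on {0..1} (\<lambda>u. s * C u v))"
  unfolding stoch_monotone_sign_def
proof (rule ball_cong[OF refl])
  fix v :: real assume v: "v \<in> {0..1}"
  show "(\<exists>g. mono_on {0..1} g \<and> (AE u in lebesgue_on {0..1}. partial1 C u v = s * g u))
      \<longleftrightarrow> convex_on {0..1} (\<lambda>u. s * C u v)"
  proof
    assume "\<exists>g. mono_on {0..1} g \<and> (AE u in lebesgue_on {0..1}. partial1 C u v = s * g u)"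
    then obtain g where g: "mono_on {0..1} g" "AE u in lebesgue_on {0..1}. partial1 C u v = s * g u"
      by blast
    obtain N where N: "negligible N" "\<And>u. u \<in> {0..1} - N \<Longrightarrow> dens v u = s * g u"
      using dens_eq_if_partial1_eq[OF v g(2)] by metis
    show "convex_on {0..1} (\<lambda>u. s * C u v)"
    proof (rule convex_on_integral_of_mono[OF g(1)])
      fix u :: real assume u: "u \<in> {0..1}"
      show "(g has_integral s * C u v) {0..u}"
      proof (rule has_integral_spike[OF N(1)])
        show "((\<lambda>x. s * dens v x) has_integral s * C u v) {0..u}"
          by (intro has_integral_mult_right has_integral_dens u v)
        show "g x = s * dens v x" if "x \<in> {0..u} - N" for x
          using N(2)[of x] that u s by (simp add: mult.assoc[symmetric])
      qed
    qed
  next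
    assume cvx: "convex_on {0..1} (\<lambda>u. s * C u v)"
    obtain N where N: "negligible N"
      "\<And>x. x \<in> {0..1} - N \<Longrightarrow> x \<in> {0<..<1}"
      "\<And>x. x \<in> {0..1} - N \<Longrightarrow> ((\<lambda>u. C u v) has_real_derivative dens v x) (at x)"
      "\<And>x. x \<in> {0..1} - N \<Longrightarrow> partial1 C x v = dens v x"
      using partial1_eq_dens[OF v] by metis
    have "mono_on ({0..1} - N) (\<lambda>x. s * dens v x)"
      by (rule mono_on_derivative_of_convex[OF cvx]) (use N in \<open>auto intro!: DERIV_cmult\<close>)
    moreover have "\<bar>s * dens v x\<bar> \<le> \<bar>s\<bar>" for x
      by (simp add: abs_mult mult_left_le)
    ultimately obtain g where g: "mono_on {0..1} g" "\<And>x. x \<in> {0..1} - N \<Longrightarrow> g x = s * dens v x"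
      using bounded_mono_on_extension[of "{0..1} - N" _ "\<bar>s\<bar>" "{0..1}"] by metis
    have "partial1 C x v = s * g x" if "x \<in> {0..1} - N" for x
      using g(2)[OF that] N(4)[OF that] s by (simp add: mult.assoc[symmetric])
    then have "{u \<in> {0..1}. partial1 C u v \<noteq> s * g u} \<subseteq> N"
      by blast
    with N(1) have "AE u in lebesgue_on {0..1}. partial1 C u v = s * g u"
      by (subst AE_lebesgue_on_iff_negligible) (auto intro: negligible_subset)
    with g(1) show "\<exists>g. mono_on {0..1} g \<and> (AE u in lebesgue_on {0..1}. partial1 C u v = s * g u)"
      by blast
  qed
qed

end

text \<open>
  Let \<open>w\<close> be a convex combination of \<open>x\<close> and \<open>y\<close>, and let \<open>h\<close> be the deviation of \<open>swap.dens w\<close>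
  from the same combination of \<open>swap.dens x\<close> and \<open>swap.dens y\<close>. Its primitive \<open>H\<close> is the
  deviation from convexity of the sections of \<open>C1\<close>, so it has the sign prescribed by \<open>s1\<close>, and
  \<open>H 1 = 0\<close> because \<open>C1 u 1 = u\<close>. The deviation for the product is the integral of \<open>h\<close> against
  the monotone function \<open>s2 * m\<close>. By the second mean value theorem it equals
  \<open>s2 * (m 0 - m 1) * H c\<close> for some \<open>c\<close>, and its sign can be read off.
\<close>

lemma (in copula_pair) convex_markov_product:
  assumes s1: "s1 * s1 = 1" and s2: "s2 * s2 = (1::real)"
    and C1: "stoch_monotone_sign s1 C1" and C2: "stoch_monotone_sign s2 C2"
    and v: "v \<in> {0..1}"
  shows "convex_on {0..1} (\<lambda>u. - (s1 * s2) * D u v)"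
proof -
  have cvx: "convex_on {0..1} (\<lambda>u. s1 * C1 u t)" if "t \<in> {0..1}" for t
    using C1 that by (simp add: one.stoch_monotone_sign_iff_convex[OF s1])
  obtain m where m: "mono_on {0..1} m" "AE t in lebesgue_on {0..1}. partial1 C2 t v = s2 * m t"
    using C2 v unfolding stoch_monotone_sign_def by blast
  obtain N where N: "negligible N" "\<And>t. t \<in> {0..1} - N \<Longrightarrow> two.dens v t = s2 * m t"
    using two.dens_eq_if_partial1_eq[OF v m(2)] by metis
  show ?thesis
  proof (rule convex_on_linorderI)
    fix a x y :: real
    assume a: "0 < a" "a < 1" and xy: "x \<in> {0..1}" "y \<in> {0..1}" "x < y"
    define w where "w = (1 - a) *\<^sub>R x + a *\<^sub>R y"
    have w: "w \<in> {0..1}"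
      unfolding w_def by (rule convexD[OF convex_real_interval(5)]) (use a xy in auto)
    define h where "h t = swap.dens w t - ((1 - a) * swap.dens x t + a * swap.dens y t)" for t
    define H where "H c = C1 w c - ((1 - a) * C1 x c + a * C1 y c)" for c
    have H: "(h has_integral H c) {0..c}" if "c \<in> {0..1}" for c
      unfolding h_def H_def
      by (intro has_integral_diff has_integral_add has_integral_mult_right swap.has_integral_dens that w xy)
    have H1: "H 1 = 0"
      using swap.C_1_left w xy by (simp add: H_def w_def)
    have sH: "s1 * H c \<le> 0" if c: "c \<in> {0..1}" for c
      using convex_onD[OF cvx[OF c], of a x y] a xy
      by (simp add: H_def w_def algebra_simps)
    have "h integrable_on {0..1}" using H[of 1] by auto
    then obtain c where c: "c \<in> {0..1}"
      and mv: "integral {0..1} (\<lambda>t. m t * h t) = m 0 * integral {0..c} h + m 1 * integral {c..1} h"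
    proof (rule second_mean_value_theorem)
      show "m a \<le> m b" if "0 \<le> a" "a \<le> b" "b \<le> 1" for a b
        using that by (intro mono_onD[OF m(1)]) auto
    qed simp_all
    have "integral {0..c} h + integral {c..1} h = integral {0..1} h"
      using c \<open>h integrable_on {0..1}\<close>
      by (intro Henstock_Kurzweil_Integration.integral_combine) auto
    then have "integral {c..1} h = - H c"
      using integral_unique[OF H[of c]] integral_unique[OF H[of 1]] c H1 by simp
    then have mh: "integral {0..1} (\<lambda>t. m t * h t) = (m 0 - m 1) * H c"
      using mv integral_unique[OF H[of c]] c by (simp add: algebra_simps)
    have "((\<lambda>t. h t * two.dens v t) has_integral D w v - ((1 - a) * D x v + a * D y v)) {0..1}"
      using has_integral_diff[OF has_integral_markov_product[OF w v]
          has_integral_add[OF has_integral_mult_right[OF has_integral_markov_product[OF xy(1) v], of "1 - a"]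
            has_integral_mult_right[OF has_integral_markov_product[OF xy(2) v], of a]]]
      by (simp add: h_def algebra_simps)
    then have "((\<lambda>t. s2 * (m t * h t)) has_integral D w v - ((1 - a) * D x v + a * D y v)) {0..1}"
      by (rule has_integral_spike[OF N(1), rotated]) (use N(2) in auto)
    then have dev: "D w v - ((1 - a) * D x v + a * D y v) = s2 * ((m 0 - m 1) * H c)"
      using mh by (auto dest!: integral_unique)
    have "s1 * s2 * (D w v - ((1 - a) * D x v + a * D y v)) = (s2 * s2) * ((m 0 - m 1) * (s1 * H c))"
      unfolding dev by (simp add: algebra_simps)
    also have "\<dots> \<ge> 0"
      unfolding s2 using sH[OF c] mono_onD[OF m(1), of 0 1] by (auto intro!: mult_nonpos_nonpos)
    finally show "- (s1 * s2) * D ((1 - a) *\<^sub>R x + a *\<^sub>R y) v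
        \<le> (1 - a) * (- (s1 * s2) * D x v) + a * (- (s1 * s2) * D y v)"
      unfolding w_def[symmetric] by (simp add: algebra_simps)
  qed simp
qed

lemma stoch_monotone_sign_markov_product:
  assumes "copula2 C1" "copula2 C2" and s: "s1 * s1 = 1" "s2 * s2 = 1"
    and C: "stoch_monotone_sign s1 C1" "stoch_monotone_sign s2 C2"
  shows "stoch_monotone_sign (- (s1 * s2)) (markov_product C1 C2)"
proof -
  obtain M1 M2 where "copula_law M1 C1" "copula_law M2 C2"
    using assms(1,2) by (auto simp: copula2_iff)
  then interpret copula_pair M1 C1 M2 C2 by (rule copula_pair.intro)
  obtain M where "copula_law M D"
    using copula2_markov_product by (auto simp: copula2_iff)
  moreover have "- (s1 * s2) * - (s1 * s2) = 1"
    using s by (simp add: mult.assoc mult.left_commute)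
  ultimately show ?thesis
    using convex_markov_product[OF s C] by (simp add: copula_law.stoch_monotone_sign_iff_convex)
qed

lemma copula2_markov_product:
  assumes "copula2 C1" "copula2 C2"
  shows "copula2 (markov_product C1 C2)"
proof -
  obtain M1 M2 where "copula_law M1 C1" "copula_law M2 C2"
    using assms by (auto simp: copula2_iff)
  then show ?thesis
    by (intro copula_pair.copula2_markov_product copula_pair.intro)
qed

theorem corollary4p1:
  fixes C1 C2 :: "real \<Rightarrow> real \<Rightarrow> real"
  assumes "copula2 C1" and "copula2 C2"
    and "stoch_monotone1 C1" and "stoch_monotone1 C2"
  shows "copula2 (markov_product C1 C2) \<and>
    stoch_monotone1 (markov_product C1 C2) \<and>
    ((stoch_increasing1 C1 \<and> stoch_increasing1 C2) \<or> (stoch_decreasing1 C1 \<and> stoch_decreasing1 C2)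
       \<longrightarrow> stoch_increasing1 (markov_product C1 C2)) \<and>
    ((stoch_increasing1 C1 \<and> stoch_decreasing1 C2) \<or> (stoch_decreasing1 C1 \<and> stoch_increasing1 C2)
       \<longrightarrow> stoch_decreasing1 (markov_product C1 C2))"
proof -
  note sign_rule = stoch_monotone_sign_markov_product[OF assms(1,2)]
  show ?thesis
    using copula2_markov_product[OF assms(1,2)] assms(3,4)
      sign_rule[of 1 1] sign_rule[of 1 "-1"] sign_rule[of "-1" 1] sign_rule[of "-1" "-1"]
    unfolding stoch_monotone1_def stoch_decreasing1_iff_sign stoch_increasing1_iff_sign
    by auto
qed

end
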